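(* Let $L,R>0$ and let $N$ be a positive integer. Then for any first-order method $A$ that performs at most $N$ calls to its first-order oracle and any dimension $d\geq N+1$, there exist a convex function $w_A\in C^{1,1}_L(\mathbb{R}^d)$ and a point $x_0\in\mathbb{R}^d$ such that $\|x_*-x_0\|\leq R$ for some minimizer $x_*$ of $w_A$, and \[ w_A\big(A(\mathcal{O}_{w_A},x_0)\big)-w_A^*\;\geq\;\frac{LR^2}{2\theta_N^2}, \] where $w_A^*=\min_{x} w_A(x)$ and $\theta_N$ is defined by $\theta_0=1$, $\theta_i=\frac{1+\sqrt{1+4\theta_{i-1}^2}}{2}$ for $i=1,\dots,N-1$, and $\theta_N=\frac{1+\sqrt{1+8\theta_{N-1}^2}}{2}$.
   Context: $C^{1,1}_L(\mathbb{R}^d)$ denotes the set of differentiable functions $f:\mathbb{R}^d\to\mathbb{R}$ whose gradient is Lipschitz continuous with constant $L$ (w.r.t. the Euclidean norm). A first-order oracle $\mathcal{O}_f$ for $f$ is a subroutine that, given a point $x\in\mathbb{R}^d$, returns $(f(x),\nabla f(x))$. A first-order method $A$ is an algorithm that receives a reference (starting) point $x_0\in\mathbb{R}^d$ and gains information on the objective $f$ only by querying $\mathcal{O}_f$: each query point (search point) is chosen based on $x_0$ and the oracle answers obtained so far, and after finitely many queries it outputs an approximate solution $A(\mathcal{O}_f,x_0)\in\mathbb{R}^d$, which likewise depends only on $x_0$ and the oracle answers received. The method has a built-in stopping criterion not depending on external input. *)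

theory Defs
  imports "HOL-Analysis.Analysis"
begin

definition grad :: "(real^'d \<Rightarrow> real) \<Rightarrow> real^'d \<Rightarrow> real^'d" where
  "grad f x = (THE D. GDERIV f x :> D)"

definition C11 :: "real \<Rightarrow> (real^'d \<Rightarrow> real) \<Rightarrow> bool" where
  "C11 L f \<longleftrightarrow> (\<forall>x. f differentiable (at x)) \<and>
     (\<forall>x y. norm (grad f x - grad f y) \<le> L * norm (x - y))"

type_synonym 'd orcl = "real^'d \<Rightarrow> real \<times> (real^'d)"

definition fo_orc :: "(real^'d \<Rightarrow> real) \<Rightarrow> 'd orcl" where
  "fo_orc f = (\<lambda>x. (f x, grad f x))"

(* A (deterministic) first-order method: given the reference point x0 and the history
  of (query point, orcl answer) pairs so far, it either issues the next query
  (Inl q) or stops and outputs its approximate solution (Inr y). *)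
type_synonym 'd fom =
  "real^'d \<Rightarrow> ((real^'d) \<times> (real \<times> (real^'d))) list \<Rightarrow> (real^'d) + (real^'d)"

fun fom_hist :: "('d::finite) fom \<Rightarrow> 'd orcl \<Rightarrow> real^'d \<Rightarrow> nat
                 \<Rightarrow> ((real^'d) \<times> (real \<times> (real^'d))) list" where
  "fom_hist A Q x0 0 = []"
| "fom_hist A Q x0 (Suc k) =
     (let h = fom_hist A Q x0 k in
      case A x0 h of Inl q \<Rightarrow> h @ [(q, Q q)] | Inr _ \<Rightarrow> h)"

definition at_most_calls :: "('d::finite) fom \<Rightarrow> nat \<Rightarrow> bool" where
  "at_most_calls A N \<longleftrightarrow> (\<forall>Q x0. (\<exists>y. A x0 (fom_hist A Q x0 N) = Inr y))"

definition fom_output :: "('d::finite) fom \<Rightarrow> nat \<Rightarrow> 'd orcl \<Rightarrow> real^'d \<Rightarrow> real^'d" where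
  "fom_output A N Q x0 = (case A x0 (fom_hist A Q x0 N) of Inr y \<Rightarrow> y | Inl q \<Rightarrow> q)"

fun theta :: "nat \<Rightarrow> real" where
  "theta 0 = 1"
| "theta (Suc i) = (1 + sqrt (1 + 4 * (theta i)\<^sup>2)) / 2"

(* Last step: theta_N = (1 + sqrt(1 + 8 theta_{N-1}^2))/2 (used for N \<ge> 1). *)
definition theta_last :: "nat \<Rightarrow> real" where
  "theta_last N = (1 + sqrt (1 + 8 * (theta (N - 1))\<^sup>2)) / 2"

end

theory Submission
  imports Defs
begin

text \<open>For an orthonormal family \<open>e\<^sub>0, \<dots>, e\<^sub>N\<close> and slopes \<open>g\<^sub>i = r\<^sub>i e\<^sub>i\<close>, the hard function is \<open>L\<close> times
  the Moreau envelope of \<open>x \<mapsto> max 0 (max\<^sub>i (g\<^sub>i \<bullet> x + a\<^sub>i))\<close>. Since \<open>a\<^sub>i - r\<^sub>i\<^sup>2 \<ge> a\<^sub>j\<close> for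
  \<open>i < j\<close>, its value and gradient at a point of \<open>span {e\<^sub>0, \<dots>, e\<^sub>k}\<close> with nonnegative last coordinate do
  not involve \<open>e\<^sub>j\<close> for \<open>j > k\<close>. The adversary therefore fixes \<open>e\<^sub>k\<close> only after seeing the query
  number \<open>k\<close> (counted from 0), and \<open>e\<^sub>N\<close> after seeing the output, always such that the point lies in this
  region. Choosing \<open>N + 1\<close> vectors in this way needs no more than dimension \<open>N + 1\<close>. At the output the
  value is at least \<open>L (a\<^sub>N - r\<^sub>N\<^sup>2 / 2)\<close>, while the minimum is 0, attained at distance
  \<open>sqrt (\<Sum>i. a\<^sub>i\<^sup>2 / r\<^sub>i\<^sup>2)\<close> from the origin; optimising the coefficients gives the constant
  \<open>\<theta>\<^sub>N\<close>.\<close>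

section \<open>The Moreau envelope of a support function\<close>

text \<open>The envelope of the support function of P is
  \<open>u \<mapsto> max {p \<bullet> u - |p|^2 / 2 | p \<in> P}\<close>, and its maximiser, the projection onto P, is its gradient.\<close>

definition support_env :: "'a::euclidean_space set \<Rightarrow> 'a \<Rightarrow> real" where
  "support_env P u = closest_point P u \<bullet> u - (norm (closest_point P u))\<^sup>2 / 2"

lemma support_env_ge:
  assumes "closed P" "p \<in> P"
  shows "p \<bullet> u - (norm p)\<^sup>2 / 2 \<le> support_env P u"
proof -
  let ?c = "closest_point P u"
  have "norm (u - ?c) \<le> norm (u - p)"
    using closest_point_le[OF assms] by (simp add: dist_norm)
  then have "(norm (u - ?c))\<^sup>2 \<le> (norm (u - p))\<^sup>2"
    by (simp add: power_mono)
  then show ?thesis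
    unfolding support_env_def power2_norm_eq_inner
    by (simp add: inner_diff_left inner_diff_right inner_commute)
qed

lemma support_env_subgradient:
  assumes "closed P" "P \<noteq> {}"
  shows "support_env P u + (v - u) \<bullet> closest_point P u \<le> support_env P v"
  using support_env_ge[OF assms(1) closest_point_in_set[OF assms], of u v]
  by (simp add: support_env_def inner_diff_right inner_commute[of "v - u"])

text \<open>Average the inequalities based at the convex combination \<open>z\<close>: the linear
  terms cancel.\<close>

lemma convex_on_of_subgradient:
  fixes f :: "'a::real_inner \<Rightarrow> real"
  assumes "\<And>u v. f u + (v - u) \<bullet> G u \<le> f v"
  shows "convex_on UNIV f"
proof (rule convex_onI)
  fix t :: real and x y :: 'a
  assume t: "0 < t" "t < 1"
  define z where "z = (1 - t) *\<^sub>R x + t *\<^sub>R y"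
  have "(1 - t) * (f z + (x - z) \<bullet> G z) + t * (f z + (y - z) \<bullet> G z) \<le> (1 - t) * f x + t * f y"
    using t assms by (intro add_mono mult_left_mono) auto
  moreover have "(1 - t) * ((x - z) \<bullet> G z) + t * ((y - z) \<bullet> G z) = 0"
    by (simp add: z_def inner_diff_left inner_add_left algebra_simps)
  ultimately show "f ((1 - t) *\<^sub>R x + t *\<^sub>R y) \<le> (1 - t) * f x + t * f y"
    unfolding z_def[symmetric] by (simp add: algebra_simps)
qed simp

text \<open>The subgradient inequalities at both endpoints squeeze the remainder of the linearisation
  between 0 and \<open>L |v - u|^2\<close>.\<close>

lemma GDERIV_of_lipschitz_subgradient:
  fixes f :: "'a::real_inner \<Rightarrow> real"
  assumes sub: "\<And>u v. f u + (v - u) \<bullet> G u \<le> f v"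
    and lip: "\<And>u v. norm (G u - G v) \<le> L * norm (u - v)"
  shows "GDERIV f u :> G u"
  unfolding gderiv_def
proof (rule has_derivativeI_sandwich[where e = 1 and H = "\<lambda>v. L * norm (v - u)"])
  fix v
  assume "v \<noteq> u"
  have "f v - f u - (v - u) \<bullet> G u \<le> (v - u) \<bullet> (G v - G u)"
    using sub[of v u] by (simp add: inner_diff_left inner_diff_right)
  also have "\<dots> \<le> norm (v - u) * norm (G v - G u)"
    by (rule norm_cauchy_schwarz)
  also have "\<dots> \<le> norm (v - u) * (L * norm (v - u))"
    by (intro mult_left_mono lip) simp
  finally have "norm (f v - f u - (v - u) \<bullet> G u) \<le> norm (v - u) * (L * norm (v - u))"
    using sub[of u v] by simp
  then show "norm (f v - f u - (v - u) \<bullet> G u) / norm (v - u) \<le> L * norm (v - u)"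
    using \<open>v \<noteq> u\<close> by (simp add: divide_le_eq mult.commute)
next
  have "((\<lambda>v. L * norm (v - u)) \<longlongrightarrow> L * norm (u - u)) (at u)"
    by (intro tendsto_intros)
  then show "((\<lambda>v. L * norm (v - u)) \<longlongrightarrow> 0) (at u)" by simp
qed (auto intro: bounded_linear_inner_left)

text \<open>Expanding \<open>|u - z|^2\<close> around \<open>p\<close>, the assumption makes the
  cross term nonnegative. This converse of \<open>closest_point_dot\<close> identifies projections
  without computing them.\<close>

lemma closest_point_eqI:
  assumes "convex P" "closed P" "p \<in> P" "\<And>z. z \<in> P \<Longrightarrow> (u - p) \<bullet> (z - p) \<le> 0"
  shows "closest_point P u = p"
proof (rule sym, rule closest_point_unique[OF assms(1-3)], rule ballI)
  fix z
  assume "z \<in> P"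
  have "(norm (u - p))\<^sup>2 \<le> (norm (u - p))\<^sup>2 - 2 * ((u - p) \<bullet> (z - p)) + (norm (z - p))\<^sup>2"
    using assms(4)[OF \<open>z \<in> P\<close>] by (smt (verit) zero_le_power2)
  also have "\<dots> = (norm (u - z))\<^sup>2"
    unfolding power2_norm_eq_inner
    by (simp add: inner_diff_left inner_diff_right inner_commute algebra_simps)
  finally show "dist u p \<le> dist u z"
    unfolding dist_norm by (rule power2_le_imp_le) simp
qed

lemma GDERIV_unique:
  assumes "GDERIV f x :> D" "GDERIV f x :> D'"
  shows "D = D'"
proof -
  have "(\<lambda>h. h \<bullet> D) = (\<lambda>h. h \<bullet> D')"
    using assms unfolding gderiv_def by (rule has_derivative_unique)
  then have "(D - D') \<bullet> D = (D - D') \<bullet> D'" by metis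
  then have "(D - D') \<bullet> (D - D') = 0" by (simp add: inner_diff_right)
  then show ?thesis by simp
qed

lemma grad_eq: "GDERIV f x :> D \<Longrightarrow> grad f x = D"
  unfolding grad_def by (rule the_equality) (auto intro: GDERIV_unique)

section \<open>The hard function of an orthonormal family\<close>

definition orthonormal_upto :: "nat \<Rightarrow> (nat \<Rightarrow> 'a::real_inner) \<Rightarrow> bool" where
  "orthonormal_upto N e \<longleftrightarrow> (\<forall>i\<le>N. \<forall>j\<le>N. e i \<bullet> e j = (if i = j then 1 else 0))"

text \<open>The support function is the maximum of 0 and the products with the slopes; the vertex 0
  contributes the 0.\<close>

definition hard_hull :: "(nat \<Rightarrow> real) \<Rightarrow> nat \<Rightarrow> (nat \<Rightarrow> 'a::euclidean_space) \<Rightarrow> 'a set" where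
  "hard_hull r k e = convex hull (insert 0 ((\<lambda>i. r i *\<^sub>R e i) ` {..k}))"

text \<open>For an orthonormal family and nonzero \<open>r i\<close>, a common zero of all pieces
  \<open>g_i . x + a_i\<close>; translating by it absorbs the offsets.\<close>

definition hard_min ::
    "(nat \<Rightarrow> real) \<Rightarrow> (nat \<Rightarrow> real) \<Rightarrow> nat \<Rightarrow> (nat \<Rightarrow> 'a::euclidean_space) \<Rightarrow> 'a" where
  "hard_min a r N e = - (\<Sum>i\<le>N. (a i / r i) *\<^sub>R e i)"

definition hard_fun ::
    "real \<Rightarrow> (nat \<Rightarrow> real) \<Rightarrow> (nat \<Rightarrow> real) \<Rightarrow> nat \<Rightarrow> (nat \<Rightarrow> 'a::euclidean_space) \<Rightarrow> 'a \<Rightarrow> real" where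
  "hard_fun L a r N e y = L * support_env (hard_hull r N e) (y - hard_min a r N e)"

definition hard_grad ::
    "real \<Rightarrow> (nat \<Rightarrow> real) \<Rightarrow> (nat \<Rightarrow> real) \<Rightarrow> nat \<Rightarrow> (nat \<Rightarrow> 'a::euclidean_space) \<Rightarrow> 'a \<Rightarrow> 'a" where
  "hard_grad L a r N e y = L *\<^sub>R closest_point (hard_hull r N e) (y - hard_min a r N e)"

text \<open>Required for all \<open>i < j\<close>, not only consecutive indices, because every
  hidden slope is compared directly with the current one.\<close>

definition hard_coeffs :: "nat \<Rightarrow> (nat \<Rightarrow> real) \<Rightarrow> (nat \<Rightarrow> real) \<Rightarrow> bool" where
  "hard_coeffs N a r \<longleftrightarrow>
    (\<forall>i\<le>N. 0 < r i) \<and> (\<forall>j\<le>N. \<forall>i<j. a j \<le> a i - (r i)\<^sup>2)"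

lemma hard_hull_facts:
  shows convex_hard_hull: "convex (hard_hull r k e)"
    and closed_hard_hull: "closed (hard_hull r k e)"
    and zero_in_hard_hull: "0 \<in> hard_hull r k e"
    and vertex_in_hard_hull: "i \<le> k \<Longrightarrow> r i *\<^sub>R e i \<in> hard_hull r k e"
    and nonempty_hard_hull: "hard_hull r k e \<noteq> {}"
proof -
  show "closed (hard_hull r k e)"
    unfolding hard_hull_def by (intro compact_imp_closed finite_imp_compact_convex_hull) simp
  show "0 \<in> hard_hull r k e" unfolding hard_hull_def by (rule hull_inc) simp
  then show "hard_hull r k e \<noteq> {}" by blast
  show "i \<le> k \<Longrightarrow> r i *\<^sub>R e i \<in> hard_hull r k e" unfolding hard_hull_def by (rule hull_inc) simp
qed (simp add: hard_hull_def)

lemma hard_hull_inner_le: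
  assumes "p \<in> hard_hull r k e" "0 \<le> c" "\<And>i. i \<le> k \<Longrightarrow> (r i *\<^sub>R e i) \<bullet> v \<le> c"
  shows "p \<bullet> v \<le> c"
proof -
  have "convex {x. x \<bullet> v \<le> c}"
    using convex_halfspace_le[of v c] by (simp add: inner_commute)
  then have "hard_hull r k e \<subseteq> {x. x \<bullet> v \<le> c}"
    unfolding hard_hull_def using assms(2,3) by (intro hull_minimal) auto
  then show ?thesis using assms(1) by blast
qed

lemma hard_hull_inner_eq_0:
  assumes "p \<in> hard_hull r k e" "\<And>i. i \<le> k \<Longrightarrow> e i \<bullet> v = 0"
  shows "p \<bullet> v = 0"
  using hard_hull_inner_le[OF assms(1), of 0 v] hard_hull_inner_le[OF assms(1), of 0 "- v"] assms(2)
  by force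

section \<open>Convexity, smoothness and minimum of the hard function\<close>

lemma hard_fun_subgradient:
  assumes "L \<ge> 0"
  shows "hard_fun L a r N e u + (v - u) \<bullet> hard_grad L a r N e u \<le> hard_fun L a r N e v"
proof -
  let ?x = "hard_min a r N e"
  have "L * (support_env (hard_hull r N e) (u - ?x) + (v - ?x - (u - ?x)) \<bullet> closest_point (hard_hull r N e) (u - ?x))
      \<le> L * support_env (hard_hull r N e) (v - ?x)"
    by (intro mult_left_mono support_env_subgradient closed_hard_hull nonempty_hard_hull assms)
  then show ?thesis
    by (simp add: hard_fun_def hard_grad_def algebra_simps)
qed

text \<open>Projection onto a closed convex set is nonexpansive.\<close>

lemma hard_grad_lipschitz:
  assumes "L \<ge> 0"
  shows "norm (hard_grad L a r N e u - hard_grad L a r N e v) \<le> L * norm (u - v)"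
proof -
  have "dist (closest_point (hard_hull r N e) (u - hard_min a r N e))
          (closest_point (hard_hull r N e) (v - hard_min a r N e))
        \<le> dist (u - hard_min a r N e) (v - hard_min a r N e)"
    by (intro closest_point_lipschitz closed_hard_hull nonempty_hard_hull convex_hard_hull)
  then show ?thesis
    using assms
    by (simp add: hard_grad_def dist_norm scaleR_diff_right[symmetric] mult_left_mono)
qed

lemma GDERIV_hard_fun:
  assumes "L \<ge> 0"
  shows "GDERIV (hard_fun L a r N e) u :> hard_grad L a r N e u"
  using hard_fun_subgradient[OF assms] hard_grad_lipschitz[OF assms]
  by (rule GDERIV_of_lipschitz_subgradient)

lemma grad_hard_fun:
  "L \<ge> 0 \<Longrightarrow> grad (hard_fun L a r N e) x = hard_grad L a r N e x"
  by (intro grad_eq GDERIV_hard_fun)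

lemma convex_on_hard_fun: "L \<ge> 0 \<Longrightarrow> convex_on UNIV (hard_fun L a r N e)"
  by (rule convex_on_of_subgradient) (rule hard_fun_subgradient)

lemma C11_hard_fun:
  assumes "L \<ge> 0"
  shows "C11 L (hard_fun L a r N e)"
  unfolding C11_def grad_hard_fun[OF assms]
  using hard_grad_lipschitz[OF assms] GDERIV_hard_fun[OF assms, unfolded gderiv_def]
  by (blast intro: differentiableI)

lemma hard_fun_min:
  assumes "L \<ge> 0"
  shows "hard_fun L a r N e (hard_min a r N e) = 0" "0 \<le> hard_fun L a r N e x"
proof -
  show "hard_fun L a r N e (hard_min a r N e) = 0"
    by (simp add: hard_fun_def support_env_def closest_point_self zero_in_hard_hull)
  have "0 \<le> support_env (hard_hull r N e) (x - hard_min a r N e)"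
    using support_env_ge[OF closed_hard_hull zero_in_hard_hull, where u = "x - hard_min a r N e"] by simp
  then show "0 \<le> hard_fun L a r N e x"
    using assms by (simp add: hard_fun_def)
qed

lemma vertex_inner_hard_min:
  assumes "orthonormal_upto N e" "i \<le> N" "r i \<noteq> 0"
  shows "(r i *\<^sub>R e i) \<bullet> hard_min a r N e = - a i"
proof -
  have "e i \<bullet> hard_min a r N e = - (\<Sum>j\<le>N. (a j / r j) * (e i \<bullet> e j))"
    by (simp add: hard_min_def inner_sum_right)
  also have "(\<Sum>j\<le>N. (a j / r j) * (e i \<bullet> e j)) = (\<Sum>j\<le>N. if i = j then a j / r j else 0)"
    using assms by (intro sum.cong) (auto simp: orthonormal_upto_def)
  finally show ?thesis
    using assms by simp
qed

lemma norm_hard_min: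
  assumes "orthonormal_upto N e"
  shows "(norm (hard_min a r N e))\<^sup>2 = (\<Sum>i\<le>N. (a i)\<^sup>2 / (r i)\<^sup>2)"
proof -
  have "(\<Sum>i\<le>N. (a i / r i) *\<^sub>R e i) \<bullet> (\<Sum>j\<le>N. (a j / r j) *\<^sub>R e j)
      = (\<Sum>i\<le>N. \<Sum>j\<le>N. (a i / r i) * (a j / r j) * (e i \<bullet> e j))"
    unfolding inner_sum_left unfolding inner_sum_right by (simp add: inner_commute mult_ac)
  also have "\<dots> = (\<Sum>i\<le>N. \<Sum>j\<le>N. if i = j then (a i / r i) * (a j / r j) else 0)"
    using assms by (intro sum.cong) (auto simp: orthonormal_upto_def)
  also have "\<dots> = (\<Sum>i\<le>N. (a i)\<^sup>2 / (r i)\<^sup>2)"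
    by (simp add: power2_eq_square)
  finally show ?thesis
    by (simp add: hard_min_def power2_norm_eq_inner)
qed

text \<open>The envelope is a maximum over the hull, and the single vertex \<open>g_N\<close> as
  test point already yields the bound.\<close>

lemma hard_fun_ge:
  assumes "orthonormal_upto N e" "L \<ge> 0" "0 < r N" "0 \<le> y \<bullet> e N"
  shows "L * (a N - (r N)\<^sup>2 / 2) \<le> hard_fun L a r N e y"
proof -
  let ?g = "r N *\<^sub>R e N"
  have "?g \<bullet> (y - hard_min a r N e) = r N * (y \<bullet> e N) + a N"
    using vertex_inner_hard_min[OF assms(1), of N r a] assms(3)
    by (simp add: inner_diff_right inner_commute)
  moreover have "(norm ?g)\<^sup>2 = (r N)\<^sup>2"
    using assms(1) unfolding power2_norm_eq_inner
    by (simp add: orthonormal_upto_def power2_eq_square)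
  moreover have "0 \<le> r N * (y \<bullet> e N)" using assms(3,4) by simp
  ultimately have "a N - (r N)\<^sup>2 / 2 \<le> support_env (hard_hull r N e) (y - hard_min a r N e)"
    using support_env_ge[OF closed_hard_hull vertex_in_hard_hull[OF order_refl],
        where u = "y - hard_min a r N e"]
    by (smt (verit))
  then show ?thesis
    using assms(2) by (simp add: hard_fun_def mult_left_mono)
qed

text \<open>The projection \<open>p\<close> onto the smaller hull already satisfies the variational inequality of the
  larger one: with \<open>u = y - hard_min a r N e\<close>, a vertex \<open>g\<^sub>j\<close> with \<open>j > k\<close> has
  \<open>(u - p) \<bullet> g\<^sub>j = a j\<close>, while \<open>(u - p) \<bullet> g\<^sub>k \<ge> a k - (r k)\<^sup>2 \<ge> a j\<close>.\<close>

lemma closest_point_hard_hull: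
  assumes on: "orthonormal_upto N e" and "k < N"
    and coeffs: "hard_coeffs N a r"
    and y: "\<And>j. k < j \<Longrightarrow> j \<le> N \<Longrightarrow> y \<bullet> e j = 0" "0 \<le> y \<bullet> e k"
  shows "closest_point (hard_hull r N e) (y - hard_min a r N e)
       = closest_point (hard_hull r k e) (y - hard_min a r N e)"
proof -
  have r: "\<And>i. i \<le> N \<Longrightarrow> 0 < r i"
    and a: "\<And>i j. i < j \<Longrightarrow> j \<le> N \<Longrightarrow> a j \<le> a i - (r i)\<^sup>2"
    using coeffs by (auto simp: hard_coeffs_def)
  define u where "u = y - hard_min a r N e"
  define p where "p = closest_point (hard_hull r k e) u"
  have p: "p \<in> hard_hull r k e"
    unfolding p_def by (intro closest_point_in_set closed_hard_hull nonempty_hard_hull)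
  have vi: "(u - p) \<bullet> z \<le> (u - p) \<bullet> p" if "z \<in> hard_hull r k e" for z
    using closest_point_dot[OF convex_hard_hull closed_hard_hull that, of u]
    by (simp add: p_def inner_diff_right)
  have ug: "u \<bullet> (r i *\<^sub>R e i) = r i * (y \<bullet> e i) + a i" if "i \<le> N" for i
    using vertex_inner_hard_min[OF on that, of r a] r[OF that]
    by (simp add: u_def inner_diff_left inner_diff_right inner_commute algebra_simps)
  \<comment> \<open>Among the vertices of the smaller hull, only \<open>g_k\<close> has a nonzero
    product with \<open>e k\<close>.\<close>
  have "p \<bullet> (r k *\<^sub>R e k) \<le> (r k)\<^sup>2"
    using on \<open>k < N\<close>
    by (intro hard_hull_inner_le[OF p]) (auto simp: orthonormal_upto_def power2_eq_square)
  moreover have "0 \<le> r k * (y \<bullet> e k)" using r[of k] \<open>k < N\<close> y(2) by simp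
  ultimately have gk: "a k - (r k)\<^sup>2 \<le> (u - p) \<bullet> (r k *\<^sub>R e k)"
    using ug[of k] \<open>k < N\<close> unfolding inner_diff_left by linarith
  have vertex: "(u - p) \<bullet> (r j *\<^sub>R e j) \<le> (u - p) \<bullet> p" if "j \<le> N" for j
  proof (cases "j \<le> k")
    case True
    then show ?thesis by (intro vi vertex_in_hard_hull)
  next
    case False
    have "p \<bullet> (r j *\<^sub>R e j) = 0"
      using on \<open>j \<le> N\<close> False
      by (intro hard_hull_inner_eq_0[OF p]) (auto simp: orthonormal_upto_def)
    then have "(u - p) \<bullet> (r j *\<^sub>R e j) = a j"
      using ug[OF that] y(1)[of j] that False unfolding inner_diff_left by simp
    also have "\<dots> \<le> (u - p) \<bullet> (r k *\<^sub>R e k)"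
      using a[of k j] gk that False by simp
    also have "\<dots> \<le> (u - p) \<bullet> p"
      by (intro vi vertex_in_hard_hull) simp
    finally show ?thesis .
  qed
  have "0 \<le> (u - p) \<bullet> p"
    using vi[OF zero_in_hard_hull] by simp
  moreover have "(r i *\<^sub>R e i) \<bullet> (u - p) \<le> (u - p) \<bullet> p" if "i \<le> N" for i
    using vertex[OF that] by (simp only: inner_commute)
  ultimately have "(u - p) \<bullet> (z - p) \<le> 0" if "z \<in> hard_hull r N e" for z
    using hard_hull_inner_le[OF that, of "(u - p) \<bullet> p" "u - p"]
    by (simp add: inner_diff_right inner_commute)
  moreover have "p \<in> hard_hull r N e"
  proof -
    have "hard_hull r k e \<subseteq> hard_hull r N e"
      unfolding hard_hull_def using \<open>k < N\<close> by (intro hull_mono) auto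
    then show ?thesis using p by blast
  qed
  ultimately have "closest_point (hard_hull r N e) u = p"
    by (intro closest_point_eqI convex_hard_hull closed_hard_hull)
  then show ?thesis by (simp add: p_def u_def)
qed

text \<open>By \<open>closest_point_hard_hull\<close> both projections reduce to the hull of the
  common slopes, where only inner products with that hull matter. Hence an oracle answer reveals
  nothing about later vectors.\<close>

lemma hard_fun_local:
  assumes on: "orthonormal_upto N e" "orthonormal_upto N e'" and "k < N"
    and eq: "\<And>i. i \<le> k \<Longrightarrow> e' i = e i"
    and coeffs: "hard_coeffs N a r"
    and y: "y \<in> span (e ` {..k})" "0 \<le> y \<bullet> e k"
  shows "hard_fun L a r N e' y = hard_fun L a r N e y"
    and "hard_grad L a r N e' y = hard_grad L a r N e y"
proof -
  have r: "0 < r i" if "i \<le> N" for i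
    using coeffs that by (simp add: hard_coeffs_def)
  define u where "u = y - hard_min a r N e"
  define u' where "u' = y - hard_min a r N e'"
  have hull: "hard_hull r k e' = hard_hull r k e"
    unfolding hard_hull_def using eq by (intro arg_cong[where f = "(hull) convex"]) auto
  have im: "e' ` {..k} = e ` {..k}" using eq by auto
  have perp: "y \<bullet> f j = 0"
    if "orthonormal_upto N f" "y \<in> span (f ` {..k})" "k < j" "j \<le> N" for f j
  proof -
    have "orthogonal (f j) y"
      using that(2) by (rule orthogonal_to_span)
        (use that in \<open>auto simp: orthonormal_upto_def orthogonal_def\<close>)
    then show ?thesis by (simp add: orthogonal_def inner_commute)
  qed
  define p where "p = closest_point (hard_hull r k e) u"
  have p: "p \<in> hard_hull r k e"
    unfolding p_def by (intro closest_point_in_set closed_hard_hull nonempty_hard_hull)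
  \<comment> \<open>\<open>u\<close> and \<open>u'\<close> may differ, since the minimisers involve
    the later vectors, but both minimisers have product \<open>- a i\<close> with each common
    slope.\<close>
  have "e i \<bullet> (u' - u) = 0" if "i \<le> k" for i
  proof -
    have "(r i *\<^sub>R e i) \<bullet> (u' - u) = 0"
      using vertex_inner_hard_min[OF on(1), of i r a] vertex_inner_hard_min[OF on(2), of i r a]
        r[of i] eq[OF that] \<open>k < N\<close> that
      by (simp add: u_def u'_def inner_diff_right)
    then show ?thesis using r[of i] \<open>k < N\<close> that by simp
  qed
  then have diff: "z \<bullet> u' = z \<bullet> u" if "z \<in> hard_hull r k e" for z
    using hard_hull_inner_eq_0[OF that, of "u' - u"] by (simp add: inner_diff_right)
  have "closest_point (hard_hull r k e) u' = p"
  proof (rule closest_point_eqI[OF convex_hard_hull closed_hard_hull p])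
    fix z
    assume z: "z \<in> hard_hull r k e"
    have "(u - p) \<bullet> (z - p) \<le> 0"
      unfolding p_def by (rule closest_point_dot[OF convex_hard_hull closed_hard_hull z])
    then show "(u' - p) \<bullet> (z - p) \<le> 0"
      using diff[OF z] diff[OF p] by (simp add: inner_diff_left inner_diff_right inner_commute)
  qed
  moreover have "closest_point (hard_hull r N e) u = p"
    unfolding p_def u_def using on(1) y perp \<open>k < N\<close> coeffs
    by (intro closest_point_hard_hull) auto
  moreover have "closest_point (hard_hull r N e') u' = closest_point (hard_hull r k e') u'"
    unfolding u'_def using on(2) y perp \<open>k < N\<close> coeffs eq im
    by (intro closest_point_hard_hull) auto
  ultimately have "closest_point (hard_hull r N e) u = p" "closest_point (hard_hull r N e') u' = p"
    by (simp_all add: hull)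
  then show "hard_fun L a r N e' y = hard_fun L a r N e y"
      "hard_grad L a r N e' y = hard_grad L a r N e y"
    using diff[OF p]
    by (simp_all add: hard_fun_def hard_grad_def support_env_def u_def[symmetric] u'_def[symmetric])
qed

section \<open>The resisting oracle\<close>

lemma ex_orthonormal_upto:
  assumes "N < DIM('a)"
  obtains e :: "nat \<Rightarrow> 'a::euclidean_space" where "orthonormal_upto N e"
proof -
  obtain f where f: "bij_betw f {0..<DIM('a)} (Basis :: 'a set)"
    using ex_bij_betw_nat_finite[OF finite_Basis] by blast
  have "f i \<bullet> f j = (if i = j then 1 else 0)" if "i \<le> N" "j \<le> N" for i j
    using that assms bij_betwE[OF f] bij_betw_imp_inj_on[OF f]
    by (subst inner_Basis) (auto simp: inj_on_eq_iff)
  then show ?thesis by (intro that[of f]) (simp add: orthonormal_upto_def)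
qed

text \<open>The Householder reflection exchanging \<open>e k\<close> with the normalised residual of \<open>q\<close> fixes the
  vectors before \<open>e k\<close>.\<close>

lemma orthonormal_upto_adapt:
  assumes on: "orthonormal_upto N e" and "k \<le> N"
  obtains e' where "orthonormal_upto N e'" "\<And>i. i < k \<Longrightarrow> e' i = e i"
    "q \<in> span (e' ` {..k})" "0 \<le> q \<bullet> e' k"
proof -
  define s where "s = (\<Sum>i<k. (q \<bullet> e i) *\<^sub>R e i)"
  define d where "d = q - s"
  have ee: "e i \<bullet> e j = (if i = j then 1 else 0)" if "i \<le> N" "j \<le> N" for i j
    using on that by (simp add: orthonormal_upto_def)
  have s_inner: "s \<bullet> e j = (if j < k then q \<bullet> e j else 0)" if "j \<le> N" for j
  proof -
    have "s \<bullet> e j = (\<Sum>i<k. if j = i then q \<bullet> e i else 0)"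
      unfolding s_def inner_sum_left using that \<open>k \<le> N\<close>
      by (intro sum.cong) (auto simp: ee)
    then show ?thesis by simp
  qed
  then have d_perp: "d \<bullet> e j = 0" if "j < k" for j
    using that \<open>k \<le> N\<close> by (simp add: d_def inner_diff_left)
  have s_span: "s \<in> span (f ` {..k})" if "\<And>i. i < k \<Longrightarrow> f i = e i" for f
    unfolding s_def
  proof (intro span_sum span_scale span_base)
    fix i assume "i \<in> {..<k}"
    then show "e i \<in> f ` {..k}" using that[of i] by (intro image_eqI[of _ _ i]) auto
  qed
  show thesis
  proof (cases "d = 0")
    \<comment> \<open>Here \<open>q\<close> lies in the span of the vectors before
      \<open>e k\<close> and is orthogonal to \<open>e k\<close>, so \<open>e\<close> itself
      serves.\<close>
    case True
    then show ?thesis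
      using that[OF on] s_span[of e] s_inner[of k] \<open>k \<le> N\<close> by (simp add: d_def)
  next
    case False
    define u where "u = d /\<^sub>R norm d"
    define v where "v = e k - u"
    \<comment> \<open>If \<open>v = 0\<close>, the quotient is 0 by convention and \<open>T\<close>
      is the identity.\<close>
    define T where "T x = x - (2 * (x \<bullet> v) / (v \<bullet> v)) *\<^sub>R v" for x
    have uu: "u \<bullet> u = 1"
      using False by (simp add: u_def power2_norm_eq_inner[symmetric] power2_eq_square)
    have isometry: "T x \<bullet> T z = x \<bullet> z" for x z
      by (cases "v = 0")
         (simp_all add: T_def inner_diff_left inner_diff_right inner_commute field_simps)
    have fixed: "T (e i) = e i" if "i < k" for i
      using d_perp[OF that] ee[of i k] that \<open>k \<le> N\<close>
      by (simp add: T_def v_def u_def inner_diff_right inner_commute)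
    have "T (e k) = u"
    proof (cases "v = 0")
      case True
      then show ?thesis by (simp add: T_def v_def)
    next
      case False
      \<comment> \<open>Both \<open>e k\<close> and \<open>u\<close> are unit vectors, so the
        quotient in \<open>T\<close> equals 1 at \<open>e k\<close>.\<close>
      have "v \<bullet> v = 2 * (e k \<bullet> v)"
        using uu ee[of k k] \<open>k \<le> N\<close>
        by (simp add: v_def inner_diff_left inner_diff_right inner_commute)
      moreover have "v \<bullet> v \<noteq> 0" using False by simp
      ultimately have "T (e k) = e k - v" by (simp add: T_def)
      then show ?thesis by (simp add: v_def)
    qed
    show ?thesis
    proof (rule that[of "\<lambda>i. T (e i)"])
      show "orthonormal_upto N (\<lambda>i. T (e i))"
        using on by (simp add: orthonormal_upto_def isometry)
      show "T (e i) = e i" if "i < k" for i by (rule fixed[OF that])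
      have "u \<in> span ((\<lambda>i. T (e i)) ` {..k})"
        using \<open>T (e k) = u\<close> by (intro span_base) force
      then have "s + norm d *\<^sub>R u \<in> span ((\<lambda>i. T (e i)) ` {..k})"
        by (intro span_add span_scale s_span fixed)
      moreover have "s + norm d *\<^sub>R u = q"
        using False by (simp add: u_def d_def)
      ultimately show "q \<in> span ((\<lambda>i. T (e i)) ` {..k})" by simp
      have "d \<bullet> s = 0"
        unfolding s_def inner_sum_right using d_perp by simp
      then have "q \<bullet> d = d \<bullet> d"
        by (simp add: d_def inner_diff_left inner_diff_right inner_commute)
      then show "0 \<le> q \<bullet> T (e k)"
        by (simp add: \<open>T (e k) = u\<close> u_def)
    qed
  qed
qed

text \<open>A full family is present at each stage, but only its first \<open>k\<close> vectors are
  committed: quantifying over all families that share them encodes the adaptive choice. Each query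
  commits one further vector, and \<open>hard_fun_local\<close> then makes the answer independent of
  the rest.\<close>

lemma resisting_family:
  fixes A :: "'d::finite fom"
  assumes "L \<ge> 0" "N < CARD('d)"
    and coeffs: "hard_coeffs N a r"
    and "k \<le> N"
  shows "\<exists>e. orthonormal_upto N e \<and>
    (\<forall>e'. orthonormal_upto N e' \<and> (\<forall>i<k. e' i = e i) \<longrightarrow>
      fom_hist A (fo_orc (hard_fun L a r N e')) x0 k = fom_hist A (fo_orc (hard_fun L a r N e)) x0 k)"
  using \<open>k \<le> N\<close>
proof (induction k)
  case 0
  obtain e :: "nat \<Rightarrow> real^'d" where "orthonormal_upto N e"
    using ex_orthonormal_upto[where 'a = "real^'d"] \<open>N < CARD('d)\<close> by auto
  then show ?case by auto
next
  case (Suc k)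
  let ?h = "\<lambda>e k. fom_hist A (fo_orc (hard_fun L a r N e)) x0 k"
  obtain e where on: "orthonormal_upto N e"
    and e: "\<And>e'. orthonormal_upto N e' \<Longrightarrow> (\<And>i. i < k \<Longrightarrow> e' i = e i) \<Longrightarrow> ?h e' k = ?h e k"
    using Suc by auto
  \<comment> \<open>Once the method has stopped, no query is issued and \<open>y\<close> is a mere
    placeholder.\<close>
  define q where "q = (case A x0 (?h e k) of Inl q \<Rightarrow> q | Inr y \<Rightarrow> y)"
  have "k \<le> N" using Suc.prems by simp
  then obtain e1 where on1: "orthonormal_upto N e1" and e1: "\<And>i. i < k \<Longrightarrow> e1 i = e i"
    and q: "q \<in> span (e1 ` {..k})" "0 \<le> q \<bullet> e1 k"
    using orthonormal_upto_adapt[OF on] by blast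
  have "?h e' (Suc k) = ?h e1 (Suc k)"
    if on': "orthonormal_upto N e'" and eq: "\<And>i. i < Suc k \<Longrightarrow> e' i = e1 i" for e'
  proof -
    have h: "?h e' k = ?h e k" "?h e1 k = ?h e k"
      using e[OF on'] e[OF on1] eq e1 by auto
    have "fo_orc (hard_fun L a r N e') q = fo_orc (hard_fun L a r N e1) q"
      using hard_fun_local[OF on1 on' _ _ coeffs q] eq Suc.prems
      by (simp add: fo_orc_def grad_hard_fun[OF \<open>L \<ge> 0\<close>])
    then show ?thesis
      by (cases "A x0 (?h e k)") (simp_all add: Let_def h q_def)
  qed
  then show ?case using on1 by blast
qed

text \<open>The queries commit only the vectors before \<open>e N\<close>. The output depends on the
  transcript alone, so \<open>e N\<close> can be adapted to it without changing it.\<close>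

lemma resisting_lower_bound:
  fixes A :: "'d::finite fom"
  assumes "L \<ge> 0" "N < CARD('d)" "at_most_calls A N"
    and coeffs: "hard_coeffs N a r"
  obtains e where "orthonormal_upto N e"
    "L * (a N - (r N)\<^sup>2 / 2) \<le> hard_fun L a r N e (fom_output A N (fo_orc (hard_fun L a r N e)) x0)"
proof -
  let ?h = "\<lambda>e. fom_hist A (fo_orc (hard_fun L a r N e)) x0 N"
  obtain e where on: "orthonormal_upto N e"
    and e: "\<And>e'. orthonormal_upto N e' \<Longrightarrow> (\<And>i. i < N \<Longrightarrow> e' i = e i) \<Longrightarrow> ?h e' = ?h e"
    using resisting_family[OF assms(1,2) coeffs order_refl, of A x0] by auto
  obtain y where y: "A x0 (?h e) = Inr y"
    using assms(3) by (auto simp: at_most_calls_def)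
  obtain e1 where on1: "orthonormal_upto N e1" and e1: "\<And>i. i < N \<Longrightarrow> e1 i = e i"
    and pos: "0 \<le> y \<bullet> e1 N"
    using orthonormal_upto_adapt[OF on order_refl] by blast
  have "fom_output A N (fo_orc (hard_fun L a r N e1)) x0 = y"
    using e[OF on1 e1] y by (simp add: fom_output_def)
  then show ?thesis
    using that[OF on1] hard_fun_ge[OF on1 assms(1) _ pos] coeffs
    by (simp add: hard_coeffs_def)
qed

section \<open>Optimal coefficients\<close>

lemma theta_ge_1: "1 \<le> theta i"
  by (cases i) (auto simp: real_le_rsqrt)

text \<open>The quadratic formula for \<open>t^2 - t = x\<close>, serving both the recursion of
  \<open>theta\<close> and its modified last step.\<close>

lemma half_one_plus_sqrt_quadratic:
  assumes "0 \<le> x"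
  shows "((1 + sqrt (1 + 4 * x)) / 2)\<^sup>2 - (1 + sqrt (1 + 4 * x)) / 2 = x"
proof -
  define s where "s = sqrt (1 + 4 * x)"
  have "((1 + s) / 2)\<^sup>2 - (1 + s) / 2 = (s\<^sup>2 - 1) / 4"
    by (simp add: power2_eq_square field_simps)
  also have "\<dots> = x" using assms by (simp add: s_def)
  finally show ?thesis by (simp add: s_def)
qed

lemma theta_Suc_quadratic: "(theta (Suc i))\<^sup>2 - theta (Suc i) = (theta i)\<^sup>2"
  using half_one_plus_sqrt_quadratic[of "(theta i)\<^sup>2"] by simp

lemma theta_last_quadratic: "(theta_last N)\<^sup>2 - theta_last N = 2 * (theta (N - 1))\<^sup>2"
  using half_one_plus_sqrt_quadratic[of "2 * (theta (N - 1))\<^sup>2"] by (simp add: theta_last_def)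

lemma theta_last_ge_1: "1 \<le> theta_last N"
  by (auto simp: theta_last_def real_le_rsqrt)

text \<open>The quotient \<open>a i / a 0\<close> of the optimal offsets: step \<open>j\<close>
  removes the fraction \<open>1 / (2 * theta j)\<close> of \<open>a j\<close>.\<close>

definition opt_ratio :: "nat \<Rightarrow> real" where
  "opt_ratio i = (\<Prod>j<i. (2 * theta j - 1) / (2 * theta j))"

lemma opt_ratio_pos: "0 < opt_ratio i"
proof -
  have "0 < (2 * theta j - 1) / (2 * theta j)" for j
    using theta_ge_1[of j] by simp
  then show ?thesis unfolding opt_ratio_def by (intro prod_pos) auto
qed

lemma opt_ratio_Suc: "2 * theta i * opt_ratio (Suc i) = (2 * theta i - 1) * opt_ratio i"
  using theta_ge_1[of i] by (simp add: opt_ratio_def)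

text \<open>For \<open>n = N - 1\<close> this is, up to scale, the squared distance without its last
  coordinate. In the induction, \<open>theta_Suc_quadratic\<close> produces the factor
  \<open>2 * theta (Suc n) - 1\<close> that \<open>opt_ratio_Suc\<close> absorbs.\<close>

lemma sum_theta_opt_ratio:
  "(\<Sum>i\<le>n. 2 * theta i * opt_ratio i) = 4 * (theta n)\<^sup>2 * opt_ratio (Suc n)"
proof (induction n)
  case 0
  show ?case by (simp add: opt_ratio_def)
next
  case (Suc n)
  have "4 * (theta (Suc n))\<^sup>2 * opt_ratio (Suc (Suc n))
      = 2 * theta (Suc n) * (2 * theta (Suc n) * opt_ratio (Suc (Suc n)))"
    by (simp only: power2_eq_square mult_ac)
  also have "\<dots> = (4 * ((theta (Suc n))\<^sup>2 - theta (Suc n)) + 2 * theta (Suc n)) * opt_ratio (Suc n)"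
    unfolding opt_ratio_Suc by (simp add: power2_eq_square algebra_simps del: theta.simps)
  finally show ?case
    unfolding sum.atMost_Suc Suc.IH theta_Suc_quadratic by (simp add: algebra_simps del: theta.simps)
qed

text \<open>The coefficients minimise the squared distance \<open>\<Sum>i. (a i)\<^sup>2 / (r i)\<^sup>2\<close> from the start to the minimiser
  for a given final gap \<open>F = a N - (r N)\<^sup>2 / 2\<close>, subject to \<open>(r i)\<^sup>2 = a i - a (i + 1)\<close>.\<close>

lemma optimal_coefficients:
  assumes "N \<ge> 1" "F > 0"
  obtains a r :: "nat \<Rightarrow> real"
  where "hard_coeffs N a r"
    and "a N - (r N)\<^sup>2 / 2 = F"
    and "(\<Sum>i\<le>N. (a i)\<^sup>2 / (r i)\<^sup>2) = 2 * (theta_last N)\<^sup>2 * F"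
proof -
  define t where "t = theta_last N"
  have t: "1 \<le> t" unfolding t_def by (rule theta_last_ge_1)
  \<comment> \<open>Normalised so that \<open>a N = 2 * t * F / (2 * t - 1)\<close>, which makes the
    final gap \<open>F\<close>.\<close>
  define c where "c = 2 * t * F / ((2 * t - 1) * opt_ratio N)"
  define a where "a i = c * opt_ratio i" for i
  \<comment> \<open>The squares of the \<open>r i\<close>: for \<open>i < N\<close> the drop to the
    next offset, and at \<open>N\<close>, where no offset follows,
    \<open>2 * (a N - F)\<close>.\<close>
  define \<delta> where "\<delta> i = (if i < N then a i / (2 * theta i) else a N / t)" for i
  define r where "r i = sqrt (\<delta> i)" for i
  have c: "0 < c" using t assms opt_ratio_pos[of N] by (simp add: c_def)
  have apos: "0 < a i" for i using c opt_ratio_pos by (simp add: a_def)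
  have \<delta>: "0 < \<delta> i" for i
    using apos[of i] apos[of N] theta_ge_1[of i] t by (simp add: \<delta>_def)
  have r2: "(r i)\<^sup>2 = \<delta> i" for i using \<delta>[of i] by (simp add: r_def)
  have aN: "a N = 2 * t * F / (2 * t - 1)"
    using opt_ratio_pos[of N] t by (simp add: a_def c_def)
  have step: "a (Suc i) = a i - (r i)\<^sup>2" if "i < N" for i
  proof -
    have "2 * theta i * a (Suc i) = (2 * theta i - 1) * a i"
      using arg_cong[OF opt_ratio_Suc[of i], of "(*) c"] unfolding a_def by (simp only: mult_ac)
    then show ?thesis
      using that theta_ge_1[of i] unfolding r2 by (simp add: \<delta>_def field_simps)
  qed
  \<comment> \<open>Consecutive drops settle \<open>hard_coeffs\<close> only for
    \<open>j = i + 1\<close>; monotonicity extends this to all later \<open>j\<close>.\<close>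
  have anti: "a j \<le> a i" if "i \<le> j" "j \<le> N" for i j
    using that
  proof (induction rule: dec_induct)
    case (step n)
    then show ?case
      using \<open>\<And>i. i < N \<Longrightarrow> a (Suc i) = a i - (r i)\<^sup>2\<close>[of n] by (simp add: r2 \<delta> less_imp_le order_trans[rotated])
  qed simp
  obtain m where m: "N = Suc m" using assms(1) by (cases N) auto
  have "(\<Sum>i\<le>N. (a i)\<^sup>2 / (r i)\<^sup>2) = (\<Sum>i\<le>m. (a i)\<^sup>2 / (r i)\<^sup>2) + (a N)\<^sup>2 / (r N)\<^sup>2"
    by (simp add: m)
  also have "(a N)\<^sup>2 / (r N)\<^sup>2 = t * a N"
    using apos[of N] t unfolding r2 by (simp add: \<delta>_def power2_eq_square)
  also have "(\<Sum>i\<le>m. (a i)\<^sup>2 / (r i)\<^sup>2) = (\<Sum>i\<le>m. c * (2 * theta i * opt_ratio i))"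
  proof (rule sum.cong)
    fix i assume "i \<in> {..m}"
    then have "(a i)\<^sup>2 / (r i)\<^sup>2 = 2 * theta i * a i"
      using apos[of i] theta_ge_1[of i] unfolding r2 by (simp add: \<delta>_def m power2_eq_square)
    then show "(a i)\<^sup>2 / (r i)\<^sup>2 = c * (2 * theta i * opt_ratio i)"
      by (simp add: a_def)
  qed simp
  also have "\<dots> = 4 * (theta m)\<^sup>2 * a N"
    unfolding sum_distrib_left[symmetric] sum_theta_opt_ratio a_def m by (simp only: mult_ac)
  \<comment> \<open>The modified last step of \<open>theta_last\<close> enters here and lets the sum
    collapse to \<open>t * (2 * t - 1) * a N\<close>.\<close>
  also have "4 * (theta m)\<^sup>2 = 2 * (t\<^sup>2 - t)"
    using theta_last_quadratic[of N] by (simp add: t_def m)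
  also have "2 * (t\<^sup>2 - t) * a N + t * a N = t * ((2 * t - 1) * a N)"
    by (simp add: algebra_simps power2_eq_square)
  also have "\<dots> = 2 * t\<^sup>2 * F"
    using t unfolding aN by (simp add: power2_eq_square)
  finally have sum: "(\<Sum>i\<le>N. (a i)\<^sup>2 / (r i)\<^sup>2) = 2 * (theta_last N)\<^sup>2 * F"
    by (simp add: t_def)
  have "a N - (r N)\<^sup>2 / 2 = F"
  proof -
    have "a N - (r N)\<^sup>2 / 2 = a N * (2 * t - 1) / (2 * t)"
      using t unfolding r2 by (simp add: \<delta>_def field_simps)
    then show ?thesis using t unfolding aN by simp
  qed
  moreover have "hard_coeffs N a r"
    unfolding hard_coeffs_def
  proof (intro conjI allI impI)
    show "0 < r i" for i using \<delta>[of i] by (simp add: r_def)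
    show "a j \<le> a i - (r i)\<^sup>2" if "j \<le> N" "i < j" for i j
      using step[of i] anti[of "Suc i" j] that by simp
  qed
  ultimately show ?thesis using that sum by blast
qed

section \<open>Assembly of the lower bound\<close>

theorem theorem3:
  fixes L R :: real and N :: nat and A :: "'d::finite fom"
  assumes "L > 0" and "R > 0" and "N \<ge> 1"
    and "at_most_calls A N"
    and "CARD('d) \<ge> N + 1"
  shows "\<exists>(w :: real^'d \<Rightarrow> real) x0 xs.
           convex_on UNIV w \<and> C11 L w \<and>
           (\<forall>x. w xs \<le> w x) \<and> norm (xs - x0) \<le> R \<and>
           w (fom_output A N (fo_orc w) x0) - w xs \<ge> L * R\<^sup>2 / (2 * (theta_last N)\<^sup>2)"
proof -
  \<comment> \<open>With this gap the minimiser lies at distance exactly \<open>R\<close> from the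
    starting point 0.\<close>
  define F where "F = R\<^sup>2 / (2 * (theta_last N)\<^sup>2)"
  have F: "0 < F" "2 * (theta_last N)\<^sup>2 * F = R\<^sup>2"
    using theta_last_ge_1[of N] \<open>R > 0\<close> by (simp_all add: F_def)
  obtain a r :: "nat \<Rightarrow> real" where coeffs: "hard_coeffs N a r"
    and gap: "a N - (r N)\<^sup>2 / 2 = F"
    and dist: "(\<Sum>i\<le>N. (a i)\<^sup>2 / (r i)\<^sup>2) = 2 * (theta_last N)\<^sup>2 * F"
    using optimal_coefficients[OF \<open>N \<ge> 1\<close> F(1)] by blast
  have "L \<ge> 0" "N < CARD('d)" using assms by auto
  then obtain e :: "nat \<Rightarrow> real^'d" where on: "orthonormal_upto N e"
    and out: "L * (a N - (r N)\<^sup>2 / 2) \<le> hard_fun L a r N e (fom_output A N (fo_orc (hard_fun L a r N e)) 0)"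
    using resisting_lower_bound[OF _ _ \<open>at_most_calls A N\<close> coeffs] by blast
  have "(norm (hard_min a r N e))\<^sup>2 = R\<^sup>2"
    using norm_hard_min[OF on] dist F(2) by simp
  then have "norm (hard_min a r N e) = R"
    using \<open>R > 0\<close> by (simp add: power2_eq_iff_nonneg)
  then show ?thesis
    using out gap \<open>L \<ge> 0\<close>
    by (intro exI[of _ "hard_fun L a r N e"] exI[of _ 0] exI[of _ "hard_min a r N e"])
       (simp add: convex_on_hard_fun C11_hard_fun hard_fun_min F_def)
qed

end
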